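(* Let $m,n$ be positive integers and let $(S,T)$ be a pair of random variables on a common probability space taking values in $\{0,1,\dots,m\}\times\{0,1,\dots,n\}$. For $1\le s,k\le m$ and $1\le t,l\le n$ ($s,k,t,l$ integers), $$1-\frac{\overline{S}_{k,l}}{\binom{m-s+1}{k}\binom{n-t+1}{l}}\ \le\ P(S\ge s,T\ge t)\ \le\ \frac{\binom{m}{k}\binom{n}{l}-\overline{S}_{k,l}}{\left(\binom{m}{k}-\binom{m-s}{k}\right)\left(\binom{n}{l}-\binom{n-t}{l}\right)},$$ where $$\overline{S}_{k,l}=\binom{m}{k}E\left[\binom{n-T}{l}\right]+\binom{n}{l}E\left[\binom{m-S}{k}\right]-E\left[\binom{m-S}{k}\binom{n-T}{l}\right].$$
   Context: For non-negative integers $a,r$, $\binom{a}{r}$ is the usual binomial coefficient, with $\binom{a}{0}=1$ and $\binom{a}{r}=0$ if $r>a$. $E$ denotes expectation.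
   Formalization: The lower bound is stated only when its denominator C(m-s+1,k)C(n-t+1,l) is nonzero, i.e. k ≤ m-s+1 and l ≤ n-t+1; otherwise the printed fraction divides by zero and is undefined. The upper bound is stated for the full range. *)

theory Defs
  imports "HOL-Probability.Probability"
begin

text \<open>The subtractions below are on natural numbers; they do not truncate
  when \<open>S \<le> m\<close> and \<open>T \<le> n\<close> on \<open>space M\<close>.\<close>

definition S_bar ::
  "'a measure \<Rightarrow> ('a \<Rightarrow> nat) \<Rightarrow> ('a \<Rightarrow> nat) \<Rightarrow> nat \<Rightarrow> nat \<Rightarrow> nat \<Rightarrow> nat \<Rightarrow> real" where
  "S_bar M S T m n k l =
     real (m choose k) * (\<integral>\<omega>. real ((n - T \<omega>) choose l) \<partial>M)
   + real (n choose l) * (\<integral>\<omega>. real ((m - S \<omega>) choose k) \<partial>M)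
   - (\<integral>\<omega>. real ((m - S \<omega>) choose k) * real ((n - T \<omega>) choose l) \<partial>M)"

end

theory Submission
  imports Defs
begin

text \<open>Put \<open>X = (m - S choose k)\<close>, \<open>Y = (n - T choose l)\<close>, \<open>A = (m choose k)\<close>, \<open>B = (n choose l)\<close>.
  Then \<open>S_bar\<close> is the expectation of \<open>W = A Y + B X - X Y = A B - (A - X) (B - Y)\<close>. Outside the event
  one of \<open>X\<close>, \<open>Y\<close> is large, which bounds \<open>W\<close> from below; on the event both are small, which bounds
  \<open>A B - W\<close> from below. Both estimates then follow from Markov's inequality.\<close>

text \<open>Weak monotonicity reaches \<open>m - 1\<close>, and by Pascal's rule the last step to
  \<open>m\<close> adds \<open>(m - 1) choose (k - 1)\<close>, which is positive because
  \<open>k \<le> m\<close>. This makes the denominator of the upper bound positive.\<close>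

lemma binomial_less_binomial:
  assumes "a < m" "1 \<le> k" "k \<le> m"
  shows "a choose k < m choose k"
proof -
  obtain p where p: "m = Suc p" using assms by (cases m) auto
  obtain q where q: "k = Suc q" using assms by (cases k) auto
  have "a choose k \<le> p choose k" using assms p by (intro binomial_right_mono) auto
  also have "\<dots> < m choose k" using assms p q by (simp add: zero_less_binomial_iff)
  finally show ?thesis .
qed

text \<open>Where \<open>P\<close> fails, \<open>W\<close> is at least \<open>c\<close>, so Markov's
  inequality bounds the probability of the complement.\<close>

lemma (in prob_space) Markov_lower_complement:
  fixes W :: "'a \<Rightarrow> real"
  assumes "integrable M W" "{\<omega> \<in> space M. P \<omega>} \<in> events" "c > 0"
    and "\<And>\<omega>. \<omega> \<in> space M \<Longrightarrow> 0 \<le> W \<omega>"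
    and "\<And>\<omega>. \<omega> \<in> space M \<Longrightarrow> \<not> P \<omega> \<Longrightarrow> c \<le> W \<omega>"
  shows "1 - expectation W / c \<le> prob {\<omega> \<in> space M. P \<omega>}"
proof -
  have eq: "1 - prob {\<omega> \<in> space M. P \<omega>} = prob {\<omega> \<in> space M. \<not> P \<omega>}"
    using assms(2) by (subst prob_neg) auto
  have "prob {\<omega> \<in> space M. \<not> P \<omega>} \<le> prob {\<omega> \<in> space M. c \<le> W \<omega>}"
    using assms by (intro finite_measure_mono) auto
  also have "\<dots> \<le> expectation W / c"
    using assms by (intro integral_Markov_inequality_measure[where A = "{}"]) auto
  finally show ?thesis using eq by simp
qed

lemma (in prob_space) Markov_upper:
  fixes W :: "'a \<Rightarrow> real"
  assumes "integrable M W" "c > 0"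
    and "\<And>\<omega>. \<omega> \<in> space M \<Longrightarrow> 0 \<le> W \<omega>"
    and "\<And>\<omega>. \<omega> \<in> space M \<Longrightarrow> P \<omega> \<Longrightarrow> c \<le> W \<omega>"
  shows "prob {\<omega> \<in> space M. P \<omega>} \<le> expectation W / c"
proof -
  have "prob {\<omega> \<in> space M. P \<omega>} \<le> prob {\<omega> \<in> space M. c \<le> W \<omega>}"
    using assms by (intro finite_measure_mono) auto
  also have "\<dots> \<le> expectation W / c"
    using assms by (intro integral_Markov_inequality_measure[where A = "{}"]) auto
  finally show ?thesis .
qed

theorem theorem4:
  fixes M :: "'a measure" and S T :: "'a \<Rightarrow> nat" and m n s t k l :: nat
  assumes "prob_space M"
    and "m \<ge> 1" and "n \<ge> 1"
    and "(\<lambda>\<omega>. (S \<omega>, T \<omega>)) \<in> measurable M (count_space ({0..m} \<times> {0..n}))"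
    and "1 \<le> s" and "s \<le> m" and "1 \<le> k" and "k \<le> m"
    and "1 \<le> t" and "t \<le> n" and "1 \<le> l" and "l \<le> n"
  shows "(real ((m - s + 1) choose k) * real ((n - t + 1) choose l) \<noteq> 0 \<longrightarrow>
            1 - S_bar M S T m n k l / (real ((m - s + 1) choose k) * real ((n - t + 1) choose l))
              \<le> measure M {\<omega> \<in> space M. S \<omega> \<ge> s \<and> T \<omega> \<ge> t})
       \<and> measure M {\<omega> \<in> space M. S \<omega> \<ge> s \<and> T \<omega> \<ge> t}
           \<le> (real (m choose k) * real (n choose l) - S_bar M S T m n k l)
             / ((real (m choose k) - real ((m - s) choose k))
                * (real (n choose l) - real ((n - t) choose l)))"
proof -
  interpret prob_space M by fact
  define A B where "A = real (m choose k)" and "B = real (n choose l)"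
  define X Y where "X = (\<lambda>\<omega>. real ((m - S \<omega>) choose k))" and "Y = (\<lambda>\<omega>. real ((n - T \<omega>) choose l))"
  define W where "W = (\<lambda>\<omega>. A * Y \<omega> + B * X \<omega> - X \<omega> * Y \<omega>)"
  \<comment> \<open>The pair takes values in a discrete space, out of which every map is measurable;
    the projections then give \<open>S\<close> and \<open>T\<close> separately.\<close>
  have pair: "(\<lambda>\<omega>. f (S \<omega>) (T \<omega>)) \<in> measurable M N" if "\<And>i j. f i j \<in> space N"
    for f :: "nat \<Rightarrow> nat \<Rightarrow> 'b" and N
    using measurable_compose[OF assms(4), of "\<lambda>(i, j). f i j" N] that by (simp add: Pi_def)
  have [measurable]: "S \<in> measurable M (count_space UNIV)" "T \<in> measurable M (count_space UNIV)"
    using pair[of "\<lambda>i j. i"] pair[of "\<lambda>i j. j"] by simp_all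
  have [measurable]: "X \<in> borel_measurable M" "Y \<in> borel_measurable M"
    unfolding X_def Y_def by measurable
  \<comment> \<open>Truncated subtraction never exceeds \<open>m\<close> or \<open>n\<close>, so
    these bounds hold even outside \<open>space M\<close>.\<close>
  have XY: "0 \<le> X \<omega>" "X \<omega> \<le> A" "0 \<le> Y \<omega>" "Y \<omega> \<le> B" for \<omega>
    unfolding X_def Y_def A_def B_def by (auto intro: binomial_right_mono)
  have int: "integrable M X" "integrable M Y" "integrable M (\<lambda>\<omega>. X \<omega> * Y \<omega>)"
  proof -
    show "integrable M X"
      using XY by (intro integrable_const_bound[where B = A]) auto
    show "integrable M Y"
      using XY by (intro integrable_const_bound[where B = B]) auto
    have "\<bar>X \<omega> * Y \<omega>\<bar> \<le> A * B" for \<omega>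
      using mult_mono[OF XY(2) XY(4), of \<omega> \<omega>] XY[of \<omega>] by (simp add: abs_mult)
    then show "integrable M (\<lambda>\<omega>. X \<omega> * Y \<omega>)"
      by (intro integrable_const_bound[where B = "A * B"]) auto
  qed
  have intW: "integrable M W" unfolding W_def using int by auto
  have S_bar: "S_bar M S T m n k l = expectation W"
    unfolding W_def S_bar_def A_def[symmetric] B_def[symmetric]
    using int by (simp add: X_def Y_def)
  \<comment> \<open>The first two forms are sums of non-negative terms, one for each way of leaving
    the event; the factored third form serves on the event.\<close>
  have W_alt: "W \<omega> = B * X \<omega> + (A - X \<omega>) * Y \<omega>" "W \<omega> = A * Y \<omega> + (B - Y \<omega>) * X \<omega>"
    "A * B - W \<omega> = (A - X \<omega>) * (B - Y \<omega>)" for \<omega>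
    by (simp_all add: W_def algebra_simps)
  have W_nonneg: "0 \<le> W \<omega>" "0 \<le> A * B - W \<omega>" for \<omega>
    using XY[of \<omega>] W_alt(1)[of \<omega>] W_alt(3)[of \<omega>] by (auto simp: B_def)
  define a b where "a = real ((m - s + 1) choose k)" and "b = real ((n - t + 1) choose l)"
  have ab: "0 \<le> a" "a \<le> A" "0 \<le> b" "b \<le> B"
    unfolding a_def b_def A_def B_def using assms by (auto intro: binomial_right_mono)
  have W_off: "a * b \<le> W \<omega>" if "\<not> (s \<le> S \<omega> \<and> t \<le> T \<omega>)" for \<omega>
  proof (cases "s \<le> S \<omega>")
    case False
    \<comment> \<open>For integers, \<open>S \<omega> < s\<close> means
      \<open>S \<omega> + 1 \<le> s\<close>; this is the source of the \<open>+ 1\<close> in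
      \<open>a\<close>.\<close>
    then have "a \<le> X \<omega>"
      using assms unfolding a_def X_def by (auto intro!: binomial_right_mono)
    then have "a * b \<le> B * X \<omega>"
      using mult_mono[of b B a "X \<omega>"] ab XY[of \<omega>] by (simp add: mult.commute)
    then show ?thesis unfolding W_alt(1) using XY[of \<omega>] by (simp add: add_increasing2)
  next
    case True
    then have "b \<le> Y \<omega>"
      using assms that unfolding b_def Y_def by (auto intro!: binomial_right_mono)
    then have "a * b \<le> A * Y \<omega>"
      using mult_mono[of a A b "Y \<omega>"] ab XY[of \<omega>] by simp
    then show ?thesis unfolding W_alt(2) using XY[of \<omega>] by (simp add: add_increasing2)
  qed
  \<comment> \<open>If \<open>k > m - s + 1\<close> or \<open>l > n - t + 1\<close>, then
    \<open>a * b = 0\<close>, and division by zero yielding zero would turn the bound into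
    \<open>1 \<le> prob\<close>.\<close>
  have lower: "1 - expectation W / (a * b) \<le> prob {\<omega> \<in> space M. s \<le> S \<omega> \<and> t \<le> T \<omega>}"
    if "a * b \<noteq> 0"
    using that ab W_off W_nonneg intW
    by (intro Markov_lower_complement) (auto simp: less_le)
  define c d where "c = A - real ((m - s) choose k)" and "d = B - real ((n - t) choose l)"
  have cd: "0 < c" "0 < d"
    unfolding c_def d_def A_def B_def using assms by (auto intro!: binomial_less_binomial)
  \<comment> \<open>On the event \<open>m - S \<omega> \<le> m - s\<close>, hence
    \<open>A - X \<omega> \<ge> c\<close>; likewise \<open>B - Y \<omega> \<ge> d\<close>.\<close>
  have W_on: "c * d \<le> A * B - W \<omega>" if "s \<le> S \<omega> \<and> t \<le> T \<omega>" for \<omega>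
    unfolding W_alt(3) using that cd XY[of \<omega>]
    by (intro mult_mono) (auto simp: c_def d_def X_def Y_def intro!: binomial_right_mono)
  have "prob {\<omega> \<in> space M. s \<le> S \<omega> \<and> t \<le> T \<omega>} \<le> expectation (\<lambda>\<omega>. A * B - W \<omega>) / (c * d)"
    using cd W_on W_nonneg intW by (intro Markov_upper) auto
  also have "expectation (\<lambda>\<omega>. A * B - W \<omega>) = A * B - expectation W"
    using intW by (simp add: prob_space)
  finally show ?thesis
    using lower unfolding S_bar a_def b_def c_def d_def A_def B_def by blast
qed

end
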